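(* Let $A\in\mathbb{R}^{n\times n}$, and let $\mathcal{S}\subseteq\mathbb{R}^n$ be a closed and convex set. Assume that $\mathcal{S}$ is an invariant set for the continuous system $\dot{x}(t)=Ax(t)$, and let $\bar\tau=\sup\{\tau : I-A\Delta t \text{ is nonsingular for every } \Delta t\in[0,\tau]\}$. Assume that there exists $\tilde\tau>0$ such that for every $x_k\in\mathcal{S}$ and every $\Delta t\in[0,\tilde\tau]$, we have $x_k+\Delta t Ax_k\in\mathcal{S}$. Then for every $x_k\in\mathcal{S}$ and every $\Delta t\in[0,\bar\tau)$, we have $x_{k+1}\in\mathcal{S}$, where $x_{k+1}=(I-\Delta t A)^{-1}x_k$ is obtained by the backward Euler method; i.e., $\mathcal{S}$ is an invariant set for the discrete system $x_{k+1}=(I-\Delta t A)^{-1}x_k$ for every such $\Delta t$.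
   Context: A set $\mathcal{S}$ is an invariant set for $\dot x(t)=Ax(t)$ if $x(0)\in\mathcal{S}$ implies $x(t)\in\mathcal{S}$ for all $t\ge0$. It is an invariant set for a discrete system $x_{k+1}=Mx_k$ if $x_k\in\mathcal{S}$ implies $x_{k+1}\in\mathcal{S}$ for all $k\in\mathbb{N}$. In the definition of $\bar\tau$, $\tau$ ranges over nonnegative reals, and $\bar\tau$ may be $+\infty$. *)

theory Defs
  imports "HOL-Analysis.Analysis"
begin

definition solves_linear_ode :: "real^'n^'n \<Rightarrow> (real \<Rightarrow> real^'n) \<Rightarrow> bool" where
  "solves_linear_ode A x \<longleftrightarrow>
     (\<forall>t\<ge>0. (x has_vector_derivative A *v x t) (at t within {0..}))"

definition invariant_continuous :: "real^'n^'n \<Rightarrow> (real^'n) set \<Rightarrow> bool" where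
  "invariant_continuous A S \<longleftrightarrow>
     (\<forall>x. solves_linear_ode A x \<longrightarrow> x 0 \<in> S \<longrightarrow> (\<forall>t\<ge>0. x t \<in> S))"

definition invariant_discrete :: "real^'n^'n \<Rightarrow> (real^'n) set \<Rightarrow> bool" where
  "invariant_discrete M S \<longleftrightarrow>
     (\<forall>x :: nat \<Rightarrow> real^'n. (\<forall>k. x (Suc k) = M *v x k) \<longrightarrow>
        (\<forall>k. x k \<in> S \<longrightarrow> x (Suc k) \<in> S))"

(* The supremum is taken in the extended reals because it may be infinite; the set
   always contains 0. For real t with 0 \<le> t < tau_bar A, the matrix
   mat 1 - t *\<^sub>R A is invertible, so matrix_inv is the genuine inverse there. *)
definition tau_bar :: "real^'n^'n \<Rightarrow> ereal" where
  "tau_bar A =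
     Sup (ereal ` {\<tau>. 0 \<le> \<tau> \<and> (\<forall>\<Delta>t\<in>{0..\<tau>}. invertible (mat 1 - \<Delta>t *\<^sub>R A))})"

end

theory Submission
  imports Defs
begin

text \<open>
  If \<open>I - t A\<close> is invertible, then \<open>y = (I - t A)\<^sup>-\<^sup>1 x\<close> is the unique solution of
  \<open>y = x + t A y\<close>, so it suffices to find a solution in \<open>S\<close>. Whenever a linear map
  \<open>F\<close> sends \<open>S\<close> into itself and \<open>z \<in> S\<close>, convexity makes \<open>y \<mapsto> (1 - c) z + c F y\<close> a self-map of \<open>S\<close>
  for \<open>0 \<le> c \<le> 1\<close>, and for small \<open>c\<close> it is a contraction, so that Banach's theorem puts its fixed
  point in the closed set \<open>S\<close> (lemma \<open>relaxed_fixed_point\<close>). The backward Euler equation can be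
  brought into this form in two ways.

  For step sizes near \<open>0\<close>, take for \<open>F\<close> a forward Euler step \<open>I + \<tau> A\<close> that preserves \<open>S\<close>: adding
  \<open>(t / \<tau>) y\<close> to both sides of \<open>y = x + t A y\<close> gives
  \<open>(1 + t / \<tau>) y = x + (t / \<tau>) (y + \<tau> A y)\<close>, and one divides by \<open>1 + t / \<tau>\<close>.
  For step sizes \<open>t\<close> slightly beyond some \<open>s > 0\<close> whose backward Euler map \<open>R\<close> already preserves
  \<open>S\<close>, take \<open>F = R\<close>: the equation \<open>(I - t A) y = x\<close> is equivalent to
  \<open>y = R ((s / t) x + (1 - s / t) y)\<close>.

  Given an admissible step size \<open>T\<close>, all matrices \<open>I - t A\<close> with \<open>t \<in> [0, T]\<close> are
  invertible, so \<open>(I - t A)\<^sup>-\<^sup>1 x\<close> is continuous in \<open>t\<close> 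
  (lemma \<open>continuous_on_backward_euler\<close>). Since \<open>S\<close> is closed, the set of those
  \<open>t \<in> [0, T]\<close> whose backward Euler map preserves \<open>S\<close> is compact. It contains \<open>0\<close>, hence has a largest element, and by
  \<open>backward_euler_small_step\<close> (if it is \<open>0\<close>) and \<open>backward_euler_extend_step\<close> (if it is
  positive) it can only be \<open>T\<close>.
\<close>

abbreviation backward_euler :: "real^'n^'n \<Rightarrow> real \<Rightarrow> real^'n^'n" where
  "backward_euler A t \<equiv> matrix_inv (mat 1 - t *\<^sub>R A)"

lemma backward_euler_eq_iff:
  fixes A :: "real^'n^'n"
  assumes "invertible (mat 1 - t *\<^sub>R A)"
  shows "backward_euler A t *v x = y \<longleftrightarrow> y = x + t *\<^sub>R (A *v y)"
proof -
  let ?M = "mat 1 - t *\<^sub>R A"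
  have inv: "?M ** matrix_inv ?M = mat 1 \<and> matrix_inv ?M ** ?M = mat 1"
    using assms unfolding invertible_def matrix_inv_def by (rule someI_ex)
  have "backward_euler A t *v x = y \<longleftrightarrow> ?M *v y = x"
    using inv by (metis matrix_vector_mul_assoc matrix_vector_mul_lid)
  also have "?M *v y = y - t *\<^sub>R (A *v y)"
    by (simp add: matrix_vector_mult_diff_rdistrib scaleR_matrix_vector_assoc)
  finally show ?thesis
    by (auto simp: algebra_simps)
qed

lemma relaxed_fixed_point:
  fixes F :: "'a::banach \<Rightarrow> 'a"
  assumes "closed S" "convex S" "z \<in> S" and F: "\<And>y. y \<in> S \<Longrightarrow> F y \<in> S" "linear F"
    and K: "\<And>y. norm (F y) \<le> norm y * K" and c: "0 \<le> c" "c \<le> 1" "0 \<le> K" "c * K < 1"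
  obtains y where "y \<in> S" "y = (1 - c) *\<^sub>R z + c *\<^sub>R F y"
proof -
  let ?G = "\<lambda>y. (1 - c) *\<^sub>R z + c *\<^sub>R F y"
  have "\<exists>!y\<in>S. ?G y = y"
  proof (rule Banach_fix)
    show "complete S" using \<open>closed S\<close> by (simp add: complete_eq_closed)
    show "?G ` S \<subseteq> S"
      using assms by (auto intro!: convexD)
    fix x y
    have "dist (?G x) (?G y) = c * norm (F (x - y))"
      using c by (simp add: dist_norm linear_diff[OF F(2)] flip: scaleR_diff_right)
    also have "\<dots> \<le> c * (norm (x - y) * K)"
      using K c by (intro mult_left_mono)
    finally show "dist (?G x) (?G y) \<le> c * K * dist x y"
      by (simp add: dist_norm mult_ac)
  qed (use assms in auto)
  then show ?thesis using that by metis
qed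

text \<open>
  Writing \<open>w\<close> for the difference of the solutions at \<open>t\<close> and at \<open>s\<close>, and \<open>y\<close> for the one at \<open>s\<close>, the
  resolvent identity reads \<open>w = (t - s) (I - s A)\<^sup>-\<^sup>1 A (y + w)\<close>. For \<open>t\<close> close to \<open>s\<close> the term
  containing \<open>w\<close> is absorbed by the left-hand side, which leaves \<open>norm w\<close> of order \<open>\<bar>t - s\<bar>\<close>.
\<close>
lemma continuous_on_backward_euler:
  fixes A :: "real^'n^'n"
  assumes inv: "\<And>t. t \<in> T \<Longrightarrow> invertible (mat 1 - t *\<^sub>R A)"
  shows "continuous_on T (\<lambda>t. backward_euler A t *v x)"
  unfolding continuous_on_def
proof
  fix s assume s: "s \<in> T"
  define B where "B = backward_euler A s ** A"
  define y where "y = backward_euler A s *v x"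
  obtain K where K: "K > 0" "\<And>v. norm (B *v v) \<le> norm v * K"
    using bounded_linear.pos_bounded[OF matrix_vector_mul_bounded_linear[of B]] by auto
  have bound: "norm (backward_euler A t *v x - y) \<le> 2 * \<bar>t - s\<bar> * (norm y * K)"
    if "t \<in> T" and small: "\<bar>t - s\<bar> * K < 1/2" for t
  proof -
    define w where "w = backward_euler A t *v x - y"
    have "y + w = x + t *\<^sub>R (A *v (y + w))"
      using backward_euler_eq_iff[OF inv[OF \<open>t \<in> T\<close>], of x "y + w"] by (simp add: w_def)
    moreover have "t *\<^sub>R v = (t - s) *\<^sub>R v + s *\<^sub>R v" for v :: "real^'n"
      by (simp flip: scaleR_add_left)
    ultimately have "y + w = x + (t - s) *\<^sub>R (A *v (y + w)) + s *\<^sub>R (A *v (y + w))"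
      by (metis add.assoc)
    then have "backward_euler A s *v (x + (t - s) *\<^sub>R (A *v (y + w))) = y + w"
      using backward_euler_eq_iff[OF inv[OF s]] by blast
    then have "w = (t - s) *\<^sub>R (B *v (y + w))"
      by (simp add: B_def y_def matrix_vector_right_distrib matrix_vector_mult_scaleR
          flip: matrix_vector_mul_assoc)
    then have "norm w = \<bar>t - s\<bar> * norm (B *v (y + w))"
      by (metis norm_scaleR)
    also have "\<dots> \<le> \<bar>t - s\<bar> * ((norm y + norm w) * K)"
      using K by (intro mult_left_mono order.trans[OF K(2)] mult_right_mono norm_triangle_ineq) auto
    also have "\<dots> = \<bar>t - s\<bar> * (norm y * K) + (\<bar>t - s\<bar> * K) * norm w"
      by (simp add: algebra_simps)
    also have "\<dots> \<le> \<bar>t - s\<bar> * (norm y * K) + 1/2 * norm w"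
      using small by (intro add_left_mono mult_right_mono) auto
    finally show ?thesis
      by (simp add: w_def)
  qed
  have "eventually (\<lambda>t. \<bar>t - s\<bar> * K < 1/2) (at s within T)"
    by (rule order_tendstoD[where y = 0]) (auto intro!: tendsto_eq_intros)
  then have "eventually (\<lambda>t. norm (backward_euler A t *v x - y) \<le> 2 * \<bar>t - s\<bar> * (norm y * K))
      (at s within T)"
    by (auto simp: eventually_at_filter bound elim: eventually_mono)
  moreover have "((\<lambda>t. 2 * \<bar>t - s\<bar> * (norm y * K)) \<longlongrightarrow> 0) (at s within T)"
    by (auto intro!: tendsto_eq_intros)
  ultimately show "((\<lambda>t. backward_euler A t *v x) \<longlongrightarrow> backward_euler A s *v x) (at s within T)"
    unfolding y_def[symmetric] by (subst Lim_null) (rule Lim_null_comparison)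
qed

text \<open>
  A solution of \<open>y = x + t A y\<close> is a fixed point for \<open>relaxed_fixed_point\<close> with \<open>z = x\<close>, \<open>F = I + \<tau> A\<close> and
  \<open>c = t / (\<tau> + t)\<close>; this weight is at most \<open>t / \<tau>\<close>, hence small for small \<open>t\<close>.
\<close>
lemma backward_euler_small_step:
  fixes A :: "real^'n^'n"
  assumes "closed S" "convex S" "\<tau> > 0" and fwd: "\<And>x. x \<in> S \<Longrightarrow> x + \<tau> *\<^sub>R (A *v x) \<in> S"
  obtains e where "e > 0"
    "\<And>t x. 0 \<le> t \<Longrightarrow> t < e \<Longrightarrow> x \<in> S \<Longrightarrow> \<exists>y\<in>S. y = x + t *\<^sub>R (A *v y)"
proof -
  let ?F = "\<lambda>y. y + \<tau> *\<^sub>R (A *v y)"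
  have bl: "bounded_linear ?F"
    by (intro bounded_linear_intros matrix_vector_mul_bounded_linear)
  then obtain K where K: "K > 0" "\<And>v. norm (?F v) \<le> norm v * K"
    using bounded_linear.pos_bounded by blast
  show thesis
  proof
    show "\<tau> / K > 0" using K \<open>\<tau> > 0\<close> by simp
    fix t x assume t: "0 \<le> t" "t < \<tau> / K" and "x \<in> S"
    define c where "c = t / (\<tau> + t)"
    have "t * K < \<tau>"
      using t K by (simp add: field_simps)
    then have "c * K < 1"
      using t \<open>\<tau> > 0\<close> by (simp add: c_def field_simps)
    then obtain y where y: "y \<in> S" "y = (1 - c) *\<^sub>R x + c *\<^sub>R ?F y"
      using relaxed_fixed_point[of S x ?F K c] assms K t \<open>x \<in> S\<close> bounded_linear.linear[OF bl]
      by (auto simp: c_def)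
    have c: "(\<tau> + t) * c = t" "(\<tau> + t) * (1 - c) = \<tau>"
      using t \<open>\<tau> > 0\<close> by (simp_all add: c_def field_simps)
    define q where "q = ?F y"
    have "(\<tau> + t) *\<^sub>R y = \<tau> *\<^sub>R x + t *\<^sub>R q"
      using arg_cong[OF y(2)[folded q_def], of "(*\<^sub>R) (\<tau> + t)"]
      by (simp only: scaleR_add_right scaleR_scaleR c)
    then have "\<tau> *\<^sub>R y = \<tau> *\<^sub>R (x + t *\<^sub>R (A *v y))"
      by (simp add: q_def algebra_simps)
    then have "y = x + t *\<^sub>R (A *v y)"
      using \<open>\<tau> > 0\<close> by simp
    with y(1) show "\<exists>y\<in>S. y = x + t *\<^sub>R (A *v y)" by blast
  qed
qed

text \<open>
  Here \<open>F = (I - s A)\<^sup>-\<^sup>1\<close>, \<open>z = F x\<close>, and the weight \<open>c = 1 - s / t\<close> tends to \<open>0\<close> as \<open>t\<close>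
  decreases to \<open>s\<close>.
\<close>
lemma backward_euler_extend_step:
  fixes A :: "real^'n^'n"
  assumes "closed S" "convex S" "s > 0" and inv: "invertible (mat 1 - s *\<^sub>R A)"
    and good: "\<And>x. x \<in> S \<Longrightarrow> backward_euler A s *v x \<in> S"
  obtains e where "e > 0"
    "\<And>t x. s \<le> t \<Longrightarrow> t < s + e \<Longrightarrow> x \<in> S \<Longrightarrow> \<exists>y\<in>S. y = x + t *\<^sub>R (A *v y)"
proof -
  let ?F = "\<lambda>y. backward_euler A s *v y"
  obtain K where K: "K > 0" "\<And>v. norm (?F v) \<le> norm v * K"
    using bounded_linear.pos_bounded[OF matrix_vector_mul_bounded_linear] by blast
  show thesis
  proof
    show "s / K > 0" using K \<open>s > 0\<close> by simp
    fix t x assume t: "s \<le> t" "t < s + s / K" and "x \<in> S"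
    define c where "c = 1 - s / t"
    have "(t - s) * K < s"
      using t K by (simp add: field_simps)
    then have "c * K < 1"
      using t \<open>s > 0\<close> by (simp add: c_def field_simps)
    then obtain y where y: "y \<in> S" "y = (1 - c) *\<^sub>R ?F x + c *\<^sub>R ?F y"
      using relaxed_fixed_point[of S "?F x" ?F K c] assms K t \<open>x \<in> S\<close>
      by (auto simp: c_def)
    have "backward_euler A s *v ((1 - c) *\<^sub>R x + c *\<^sub>R y) = y"
      using y(2) by (simp add: matrix_vector_right_distrib matrix_vector_mult_scaleR)
    then have eq: "y = (1 - c) *\<^sub>R x + c *\<^sub>R y + s *\<^sub>R (A *v y)"
      using backward_euler_eq_iff[OF inv] by blast
    have c: "t * c = t - s" "t * (1 - c) = s"
      using t \<open>s > 0\<close> by (simp_all add: c_def field_simps)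
    have "t *\<^sub>R y = s *\<^sub>R x + (t - s) *\<^sub>R y + (t * s) *\<^sub>R (A *v y)"
      using arg_cong[OF eq, of "(*\<^sub>R) t"] by (simp only: scaleR_add_right scaleR_scaleR c)
    then have "s *\<^sub>R y = s *\<^sub>R (x + t *\<^sub>R (A *v y))"
      by (simp add: algebra_simps)
    then have "y = x + t *\<^sub>R (A *v y)"
      using \<open>s > 0\<close> by simp
    with y(1) show "\<exists>y\<in>S. y = x + t *\<^sub>R (A *v y)" by blast
  qed
qed

lemma backward_euler_preserves:
  fixes A :: "real^'n^'n"
  assumes S: "closed S" "convex S" and fwd: "\<tau> > 0" "\<And>x. x \<in> S \<Longrightarrow> x + \<tau> *\<^sub>R (A *v x) \<in> S"
    and "0 \<le> T" and inv: "\<And>t. t \<in> {0..T} \<Longrightarrow> invertible (mat 1 - t *\<^sub>R A)"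
    and "x \<in> S"
  shows "backward_euler A T *v x \<in> S"
proof -
  define good where "good = {t \<in> {0..T}. \<forall>x\<in>S. backward_euler A t *v x \<in> S}"
  have "closed (\<Inter>x\<in>S. {0..T} \<inter> (\<lambda>t. backward_euler A t *v x) -` S)"
    using S by (intro closed_INT ballI continuous_closed_preimage continuous_on_backward_euler inv) auto
  moreover have "good = {0..T} \<inter> (\<Inter>x\<in>S. {0..T} \<inter> (\<lambda>t. backward_euler A t *v x) -` S)"
    by (auto simp: good_def)
  ultimately have "compact good"
    by (simp only: compact_Int_closed compact_Icc)
  moreover have "backward_euler A 0 *v x = x" for x
    using \<open>0 \<le> T\<close> backward_euler_eq_iff[OF inv[of 0], of x x] by simp
  then have "0 \<in> good"
    using \<open>0 \<le> T\<close> by (auto simp: good_def)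
  ultimately obtain s where s: "s \<in> good" and max: "\<And>t. t \<in> good \<Longrightarrow> t \<le> s"
    using compact_attains_sup[of good] by blast
  obtain e where e: "e > 0"
    "\<And>t x. s \<le> t \<Longrightarrow> t < s + e \<Longrightarrow> x \<in> S \<Longrightarrow> \<exists>y\<in>S. y = x + t *\<^sub>R (A *v y)"
  proof (cases "s = 0")
    case True
    with that show thesis
      using backward_euler_small_step[OF S fwd] by auto
  next
    case False
    with s have "s > 0" "invertible (mat 1 - s *\<^sub>R A)"
      "\<And>x. x \<in> S \<Longrightarrow> backward_euler A s *v x \<in> S"
      using inv by (auto simp: good_def)
    with that show thesis
      using backward_euler_extend_step[OF S] by blast
  qed
  define t where "t = min T (s + e / 2)"
  have t: "s \<le> t" "t < s + e" "t \<in> {0..T}"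
    using s e(1) by (auto simp: t_def good_def)
  then have "t \<in> good"
    using e(2)[OF t(1,2)] backward_euler_eq_iff[OF inv[OF t(3)]] by (force simp: good_def)
  then have "t = T"
    using max[of t] e(1) by (auto simp: t_def min_def split: if_splits)
  with \<open>t \<in> good\<close> \<open>x \<in> S\<close> show ?thesis
    by (simp add: good_def)
qed

lemma invertible_below_tau_bar:
  assumes "ereal T < tau_bar A" "t \<in> {0..T}"
  shows "invertible (mat 1 - t *\<^sub>R A)"
  using assms unfolding tau_bar_def less_Sup_iff by auto

theorem theorem4p19:
  fixes A :: "real^'n^'n" and S :: "(real^'n) set"
  assumes "closed S" and "convex S"
    and "invariant_continuous A S"
    and "\<exists>\<tau>>0. \<forall>x\<in>S. \<forall>\<Delta>t\<in>{0..\<tau>}. x + \<Delta>t *\<^sub>R (A *v x) \<in> S"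
  shows "\<forall>\<Delta>t::real. 0 \<le> \<Delta>t \<longrightarrow> ereal \<Delta>t < tau_bar A \<longrightarrow>
           (\<forall>x\<in>S. matrix_inv (mat 1 - \<Delta>t *\<^sub>R A) *v x \<in> S) \<and>
           invariant_discrete (matrix_inv (mat 1 - \<Delta>t *\<^sub>R A)) S"
proof (intro allI impI)
  fix T :: real
  assume T: "0 \<le> T" "ereal T < tau_bar A"
  obtain \<tau> where "\<tau> > 0" "\<And>x. x \<in> S \<Longrightarrow> x + \<tau> *\<^sub>R (A *v x) \<in> S"
    using assms(4) by force
  then have "\<forall>x\<in>S. backward_euler A T *v x \<in> S"
    using backward_euler_preserves[OF assms(1,2)] T invertible_below_tau_bar by blast
  then show "(\<forall>x\<in>S. backward_euler A T *v x \<in> S) \<and> invariant_discrete (backward_euler A T) S"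
    by (simp add: invariant_discrete_def)
qed

end
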